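(* Let $N \geq 2$, let $v_1, \dots, v_N \in \mathbb{C}^r$ form an equiangular tight frame, and let $V \in \mathbb{C}^{r \times N}$ have the $v_i$ as its columns. Then $$\mathrm{sparsity}(V) \geq N\left(1 + \frac{(r-1)^2}{N-1}\right)^{-1},$$ $$\mathrm{spark}(V) \geq N\left(1 + \frac{(N-r-1)^2}{N-1}\right)^{-1}.$$
   Context: Unit vectors $v_1, \dots, v_N \in \mathbb{C}^r$ form a unit norm tight frame (UNTF) if $\sum_{i=1}^N v_i v_i^* = \frac{N}{r} I_r$. They form an equiangular tight frame (ETF) if moreover there exists $\alpha \in [0,1]$ such that $|\langle v_i, v_j \rangle| = \alpha$ whenever $i \neq j$. For a vector $x$, $\|x\|_0$ is the number of its nonzero entries. For $V \in \mathbb{C}^{r \times N}$, $\mathrm{row}(V) \subseteq \mathbb{C}^N$ is the span of the rows of $V$, and $$\mathrm{spark}(V) = \min\{\|x\|_0 : x \in \mathbb{C}^N \setminus \{0\},\ Vx = 0\}, \qquad \mathrm{sparsity}(V) = \min\{\|x\|_0 : x \in \mathrm{row}(V) \setminus \{0\}\}.$$ (If $r = N$ the set defining the spark is empty, and the spark is understood as $+\infty$.) *)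

theory Defs
  imports "HOL-Analysis.Analysis"
begin

text \<open>
  The space of dimension r is the type complex ^ 'r with r = CARD('r), and the N vectors are
  indexed by a finite type 'n with N = CARD('n).  The library's inner product on complex ^ 'r is
  the real one, that is, the real part of the Hermitian product needed here; its norm is the
  Hermitian norm.
\<close>

definition hermitian_inner :: "complex ^ 'r \<Rightarrow> complex ^ 'r \<Rightarrow> complex" where
  "hermitian_inner x y = (\<Sum>a\<in>UNIV. x $ a * cnj (y $ a))"

text \<open>The rank-one matrix x y*.\<close>

definition outer :: "complex ^ 'r \<Rightarrow> complex ^ 'r \<Rightarrow> complex ^ 'r ^ 'r" where
  "outer x y = (\<chi> a b. x $ a * cnj (y $ b))"

definition unit_norm_tight_frame :: "('n::finite \<Rightarrow> complex ^ 'r) \<Rightarrow> bool" where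
  "unit_norm_tight_frame v \<longleftrightarrow>
     (\<forall>i. norm (v i) = 1) \<and>
     (\<Sum>i\<in>UNIV. outer (v i) (v i)) = (real CARD('n) / real CARD('r)) *\<^sub>R mat 1"

definition equiangular_tight_frame :: "('n::finite \<Rightarrow> complex ^ 'r) \<Rightarrow> bool" where
  "equiangular_tight_frame v \<longleftrightarrow>
     unit_norm_tight_frame v \<and>
     (\<exists>\<alpha>::real\<in>{0..1}. \<forall>i j. i \<noteq> j \<longrightarrow> cmod (hermitian_inner (v i) (v j)) = \<alpha>)"

definition l0_norm :: "complex ^ 'n \<Rightarrow> nat" where
  "l0_norm x = card {i. x $ i \<noteq> 0}"

text \<open>
  The spark is an extended natural number, because the infimum of the empty set in that type
  is infinity, as required when V has trivial kernel.
\<close>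

definition spark :: "complex ^ 'n ^ 'r \<Rightarrow> enat" where
  "spark V = (INF x \<in> {x. x \<noteq> 0 \<and> V *v x = 0}. enat (l0_norm x))"

text \<open>
  Here vec.span is the span over the complex numbers (the unqualified span is the real one).
  The minimum is taken over a nonempty set of naturals as soon as V is nonzero.
\<close>

definition sparsity :: "complex ^ 'n ^ 'r \<Rightarrow> nat" where
  "sparsity V = (INF x \<in> vec.span (rows V) - {0}. l0_norm x)"

end

theory Submission
  imports Defs
begin

text \<open>
  Write N for the number of vectors, and call an orthogonal projector of \<open>\<complex>\<^sup>N\<close> equiangular if its
  diagonal entries are all equal and its off-diagonal entries all have the same modulus.  The Gram
  matrix of an equiangular tight frame, rescaled by r / N, is such a projector P.  Its range is the
  row space of V, and the range of 1 - P, which is again equiangular and has trace N - r, consists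
  of the conjugates of the kernel vectors of V.  Both inequalities are therefore one statement: a
  nonzero vector fixed by an equiangular projector of trace k has at least
  \<open>N / (1 + (k - 1)\<^sup>2 / (N - 1))\<close> nonzero entries
  (\<open>equiangular_projector_l0_norm_ge\<close>).

  To prove it, let x be fixed by P and let S be the set of zeros of x.  Removing the line of x from
  the range of P gives a projector Q of trace k - 1
  (\<open>orthogonal_projector_deflate\<close>).  The matrix removed is a multiple of \<open>x x\<^sup>*\<close>,
  which vanishes on the rows indexed by S, so there Q still has the known entries of P.  But a
  projector of small trace cannot have a block with a large trace and small entries: by
  Cauchy-Schwarz, the squared trace of the S by S block of Q is at most trace Q times the sum of
  the squared moduli of the block's entries (\<open>orthogonal_projector_block_trace\<close>).  As
  the diagonal and the trace of P determine the common off-diagonal modulus, this is an explicit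
  inequality for the cardinality of S, and it says that x has few zeros.
\<close>

section \<open>Rank-one matrices\<close>

lemma matrix_mult_diff_ldistrib: "A ** (B - C) = A ** B - A ** (C :: complex ^ 'n ^ 'n)"
  by (simp add: vec_eq_iff matrix_matrix_mult_def right_diff_distrib sum_subtractf)

lemma matrix_mult_diff_rdistrib: "(B - C) ** A = B ** A - C ** (A :: complex ^ 'n ^ 'n)"
  by (simp add: vec_eq_iff matrix_matrix_mult_def left_diff_distrib sum_subtractf)

lemma hermitian_inner_self: "hermitian_inner x x = complex_of_real ((norm x)\<^sup>2)"
  by (simp add: hermitian_inner_def norm_vec_def L2_set_def sum_nonneg complex_mult_cnj cmod_power2)

lemma cnj_hermitian_inner: "cnj (hermitian_inner x y) = hermitian_inner y x"
  by (simp add: hermitian_inner_def mult.commute)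

lemma outer_nth: "outer x y $ i $ j = x $ i * cnj (y $ j)"
  by (simp add: outer_def)

lemma outer_mult_vec: "outer x y *v z = hermitian_inner z y *s x"
  by (simp add: vec_eq_iff matrix_vector_mult_def outer_nth hermitian_inner_def
      sum_distrib_left mult_ac)

lemma matrix_mult_outer: "A ** outer x y = outer (A *v x) y"
  by (simp add: vec_eq_iff matrix_matrix_mult_def matrix_vector_mult_def outer_nth
      sum_distrib_left mult_ac)

lemma outer_mult_outer: "outer x y ** outer z w = outer (hermitian_inner z y *s x) w"
  by (simp add: matrix_mult_outer outer_mult_vec)

section \<open>Orthogonal projectors\<close>

definition orthogonal_projector :: "complex ^ 'n ^ 'n \<Rightarrow> bool" where
  "orthogonal_projector P \<longleftrightarrow> (\<forall>i j. cnj (P $ i $ j) = P $ j $ i) \<and> P ** P = P"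

lemma orthogonal_projector_entry_sum:
  assumes "orthogonal_projector P"
  shows "(\<Sum>l\<in>UNIV. P $ i $ l * P $ l $ j) = P $ i $ j"
  using assms unfolding orthogonal_projector_def
  by (metis (mono_tags, lifting) matrix_matrix_mult_def sum.cong vec_lambda_beta)

text \<open>
  This is the diagonal of \<open>P P\<^sup>* = P\<close>.  It fixes the off-diagonal modulus of an
  equiangular projector, and it shows that the trace of a projector is nonnegative.
\<close>

lemma orthogonal_projector_row_norm:
  assumes "orthogonal_projector P"
  shows "(\<Sum>j\<in>UNIV. (cmod (P $ i $ j))\<^sup>2) = Re (P $ i $ i)"
proof -
  have "complex_of_real (\<Sum>j\<in>UNIV. (cmod (P $ i $ j))\<^sup>2) = (\<Sum>j\<in>UNIV. P $ i $ j * P $ j $ i)"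
    using assms by (simp add: orthogonal_projector_def complex_norm_square del: of_real_power)
  then show ?thesis
    unfolding orthogonal_projector_entry_sum[OF assms] by (metis Re_complex_of_real)
qed

lemma orthogonal_projector_complement:
  assumes "orthogonal_projector P"
  shows "orthogonal_projector (mat 1 - P)"
proof -
  have "(mat 1 - P) ** (mat 1 - P) = mat 1 - P - (P - P ** P)"
    by (simp add: matrix_mult_diff_ldistrib matrix_mult_diff_rdistrib)
  then show ?thesis
    using assms by (auto simp: orthogonal_projector_def mat_def)
qed

text \<open>
  The subtracted matrix R is the orthogonal projector onto the line of x.  Since x is fixed by P,
  both products of P and R are R, so that P - R projects onto the orthogonal complement of x in the
  range of P.
\<close>

lemma orthogonal_projector_deflate:
  assumes P: "orthogonal_projector P" and Px: "P *v x = x" and x: "x \<noteq> 0"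
  shows "orthogonal_projector (P - outer (complex_of_real (inverse ((norm x)\<^sup>2)) *s x) x)"
    (is "orthogonal_projector (P - ?R)")
proof -
  have herm: "cnj (P $ i $ j) = P $ j $ i" for i j
    using P by (simp add: orthogonal_projector_def)
  have PR: "P ** ?R = ?R"
    by (simp add: matrix_mult_outer vec.scale Px)
  have Rherm: "cnj (?R $ i $ j) = ?R $ j $ i" for i j
    by (simp add: outer_nth)
  have RP: "?R ** P = ?R"
  proof -
    have "(?R ** P) $ i $ j = cnj ((P ** ?R) $ j $ i)" for i j
    proof -
      have "(?R ** P) $ i $ j = (\<Sum>l\<in>UNIV. cnj (P $ j $ l) * cnj (?R $ l $ i))"
        unfolding matrix_matrix_mult_def herm Rherm by (simp add: mult.commute)
      then show ?thesis
        by (simp add: matrix_matrix_mult_def)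
    qed
    then show ?thesis
      unfolding PR Rherm by (simp add: vec_eq_iff)
  qed
  have RR: "?R ** ?R = ?R"
  proof -
    have "hermitian_inner (complex_of_real (inverse ((norm x)\<^sup>2)) *s x) x = 1"
      using hermitian_inner_self[of x] x
      by (simp add: hermitian_inner_def mult.assoc flip: sum_distrib_left of_real_mult of_real_power)
    then show ?thesis
      by (simp add: outer_mult_outer)
  qed
  have "P ** P = P"
    using P by (simp add: orthogonal_projector_def)
  then have "(P - ?R) ** (P - ?R) = P - ?R"
    unfolding matrix_mult_diff_ldistrib matrix_mult_diff_rdistrib PR RP RR by simp
  then show ?thesis
    using herm Rherm by (simp add: orthogonal_projector_def)
qed

text \<open>
  Let D be the diagonal 0-1 matrix that selects the coordinates in S, and let \<open>B = Q D Q\<close>.  Because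
  traces are cyclic and Q is idempotent, the Frobenius products of B with Q and with itself only
  involve the S by S block of Q: they are the trace of the block and the sum of its squared
  moduli.  As the Frobenius product of Q with itself is the trace of Q, the claim is the
  Cauchy-Schwarz inequality for B and Q.
\<close>

lemma orthogonal_projector_block_trace:
  fixes Q :: "complex ^ 'n ^ 'n"
  assumes Q: "orthogonal_projector Q"
  shows "(\<Sum>i\<in>S. Re (Q $ i $ i))\<^sup>2
           \<le> Re (trace Q) * (\<Sum>i\<in>S. \<Sum>j\<in>S. (cmod (Q $ i $ j))\<^sup>2)"
proof -
  have herm: "cnj (Q $ i $ j) = Q $ j $ i" for i j
    using Q by (simp add: orthogonal_projector_def)
  note idem = orthogonal_projector_entry_sum[OF Q]
  define B where "B = (\<chi> a b. \<Sum>i\<in>S. Q $ a $ i * Q $ i $ b)"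
  \<comment> \<open>The inner product of the type of matrices is the real part of the Frobenius product.\<close>
  have inner_eq: "X \<bullet> Y = Re (\<Sum>a\<in>UNIV. \<Sum>b\<in>UNIV. X $ a $ b * cnj (Y $ a $ b))"
    for X Y :: "complex ^ 'n ^ 'n"
    by (simp add: inner_vec_def inner_complex_def)
  have BX: "B \<bullet> X = Re (\<Sum>i\<in>S. \<Sum>a\<in>UNIV. \<Sum>b\<in>UNIV. Q $ a $ i * (Q $ i $ b * cnj (X $ a $ b)))"
    for X
  proof -
    have "(\<Sum>a\<in>UNIV. \<Sum>b\<in>UNIV. B $ a $ b * cnj (X $ a $ b))
      = (\<Sum>a\<in>UNIV. \<Sum>b\<in>UNIV. \<Sum>i\<in>S. Q $ a $ i * (Q $ i $ b * cnj (X $ a $ b)))"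
      by (simp add: B_def sum_distrib_right mult.assoc)
    also have "\<dots> = (\<Sum>a\<in>UNIV. \<Sum>i\<in>S. \<Sum>b\<in>UNIV. Q $ a $ i * (Q $ i $ b * cnj (X $ a $ b)))"
      by (intro sum.cong refl sum.swap)
    also have "\<dots> = (\<Sum>i\<in>S. \<Sum>a\<in>UNIV. \<Sum>b\<in>UNIV. Q $ a $ i * (Q $ i $ b * cnj (X $ a $ b)))"
      by (rule sum.swap)
    finally show ?thesis
      by (simp only: inner_eq)
  qed
  have BQ: "B \<bullet> Q = (\<Sum>i\<in>S. Re (Q $ i $ i))"
    by (simp add: BX herm idem del: Re_sum flip: sum_distrib_left) (simp add: idem mult.commute)
  have QQ: "Q \<bullet> Q = Re (trace Q)"
    by (simp add: inner_eq herm idem trace_def del: Re_sum)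
  have QB: "(\<Sum>a\<in>UNIV. \<Sum>b\<in>UNIV. Q $ a $ i * (Q $ i $ b * cnj (B $ a $ b)))
      = (\<Sum>j\<in>S. Q $ i $ j * Q $ j $ i)" for i
  proof -
    have QBi: "(\<Sum>b\<in>UNIV. Q $ i $ b * cnj (B $ a $ b)) = (\<Sum>j\<in>S. Q $ j $ a * Q $ i $ j)" for a
    proof -
      have "(\<Sum>b\<in>UNIV. Q $ i $ b * cnj (B $ a $ b))
        = (\<Sum>b\<in>UNIV. \<Sum>j\<in>S. Q $ j $ a * (Q $ i $ b * Q $ b $ j))"
        by (simp add: B_def herm sum_distrib_left mult_ac)
      also have "\<dots> = (\<Sum>j\<in>S. \<Sum>b\<in>UNIV. Q $ j $ a * (Q $ i $ b * Q $ b $ j))"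
        by (rule sum.swap)
      finally show ?thesis
        by (simp add: idem flip: sum_distrib_left)
    qed
    have "(\<Sum>a\<in>UNIV. \<Sum>b\<in>UNIV. Q $ a $ i * (Q $ i $ b * cnj (B $ a $ b)))
      = (\<Sum>a\<in>UNIV. \<Sum>j\<in>S. Q $ i $ j * (Q $ j $ a * Q $ a $ i))"
      by (simp add: QBi flip: sum_distrib_left) (simp add: sum_distrib_left mult_ac)
    also have "\<dots> = (\<Sum>j\<in>S. \<Sum>a\<in>UNIV. Q $ i $ j * (Q $ j $ a * Q $ a $ i))"
      by (rule sum.swap)
    finally show ?thesis
      by (simp add: idem flip: sum_distrib_left)
  qed
  have "Q $ i $ j * Q $ j $ i = complex_of_real ((cmod (Q $ i $ j))\<^sup>2)" for i j
    by (simp only: complex_norm_square herm)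
  then have BB: "B \<bullet> B = (\<Sum>i\<in>S. \<Sum>j\<in>S. (cmod (Q $ i $ j))\<^sup>2)"
    by (simp add: BX QB del: Re_sum flip: of_real_sum of_real_power)
  show ?thesis
    using Cauchy_Schwarz_ineq[of B Q] by (simp add: BQ BB QQ mult.commute)
qed

section \<open>Sparsity of the vectors fixed by an equiangular projector\<close>

lemma sum_diag_offdiag:
  fixes f :: "'a \<Rightarrow> 'a \<Rightarrow> real"
  assumes "finite S" "i \<in> S" "\<And>j. j \<noteq> i \<Longrightarrow> f i j = b"
  shows "(\<Sum>j\<in>S. f i j) = f i i + (real (card S) - 1) * b"
proof -
  have "real (card (S - {i})) = real (card S) - 1"
    using assms card_gt_0_iff[of S] by (auto simp: card_Diff_singleton of_nat_diff Suc_le_eq)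
  then show ?thesis
    using assms by (simp add: sum.remove[of S i])
qed

text \<open>
  The Cauchy-Schwarz bound for the block of zeros of x in the deflated projector, written out.  If
  x has z zeros, it becomes \<open>z * (N - 1 + (k - 1)\<^sup>2) \<le> N * (k - 1)\<^sup>2\<close>, which is the claim stated
  for zeros in place of nonzero entries.
\<close>

lemma equiangular_projector_l0_norm_ge:
  fixes P :: "complex ^ 'n ^ 'n"
  assumes N: "CARD('n) \<ge> 2"
    and P: "orthogonal_projector P"
    and diag: "\<And>i. P $ i $ i = complex_of_real (k / real CARD('n))"
    and offdiag: "\<And>i j. i \<noteq> j \<Longrightarrow> cmod (P $ i $ j) = \<beta>"
    and Px: "P *v x = x" and x: "x \<noteq> 0"
  shows "real (l0_norm x) \<ge>
    real CARD('n) * inverse (1 + (k - 1)\<^sup>2 / (real CARD('n) - 1))"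
proof -
  define n where "n = real CARD('n)"
  define S where "S = {i. x $ i = 0}"
  define z where "z = real (card S)"
  define Q where "Q = P - outer (complex_of_real (inverse ((norm x)\<^sup>2)) *s x) x"
  have n: "n \<ge> 2"
    using N by (simp add: n_def)
  have Q: "orthogonal_projector Q"
    unfolding Q_def by (rule orthogonal_projector_deflate[OF P Px x])
  have QP: "Q $ i $ j = P $ i $ j" if "i \<in> S" for i j
    using that by (simp add: Q_def outer_nth S_def)
  have "trace (outer (complex_of_real (inverse ((norm x)\<^sup>2)) *s x) x) = 1"
    using hermitian_inner_self[of x] x
    by (simp add: trace_def outer_nth hermitian_inner_def mult.assoc
        flip: sum_distrib_left of_real_mult of_real_power)
  moreover have "trace P = complex_of_real k"
    using n by (simp add: trace_def diag n_def)
  ultimately have trQ: "Re (trace Q) = k - 1"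
    by (simp add: Q_def trace_sub)
  \<comment> \<open>Thus the range of P has dimension at least one; a factor k is cancelled below.\<close>
  have "0 \<le> Re (trace Q)"
    by (simp add: trace_def sum_nonneg flip: orthogonal_projector_row_norm[OF Q])
  with trQ have k: "k \<ge> 1"
    by simp
  \<comment> \<open>The norm of any row of P determines the off-diagonal modulus.\<close>
  have "(k / n)\<^sup>2 + (n - 1) * \<beta>\<^sup>2 = k / n"
  proof -
    fix i :: 'n
    have "Re (P $ i $ i) = (cmod (P $ i $ i))\<^sup>2 + (n - 1) * \<beta>\<^sup>2"
      unfolding n_def orthogonal_projector_row_norm[OF P, symmetric]
      by (rule sum_diag_offdiag) (use offdiag in auto)
    moreover have "Re (P $ i $ i) = k / n" "(cmod (P $ i $ i))\<^sup>2 = (k / n)\<^sup>2"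
      by (simp_all add: diag n_def norm_divide power_divide)
    ultimately show ?thesis
      by simp
  qed
  then have "(n - 1) * \<beta>\<^sup>2 = k / n - (k / n)\<^sup>2"
    by simp
  then have \<beta>: "n\<^sup>2 * (n - 1) * \<beta>\<^sup>2 = k * (n - k)"
    using n by (simp add: mult.assoc power_divide right_diff_distrib)
      (simp add: field_simps power2_eq_square)
  have "z * (n - 1 + (k - 1)\<^sup>2) \<le> n * (k - 1)\<^sup>2"
  proof (cases "z = 0")
    case False
    then have z: "z > 0"
      by (simp add: z_def card_gt_0_iff)
    have "(\<Sum>j\<in>S. (cmod (Q $ i $ j))\<^sup>2) = (k / n)\<^sup>2 + (z - 1) * \<beta>\<^sup>2" if "i \<in> S" for i
    proof -
      have "(\<Sum>j\<in>S. (cmod (P $ i $ j))\<^sup>2) = (cmod (P $ i $ i))\<^sup>2 + (z - 1) * \<beta>\<^sup>2"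
        unfolding z_def by (rule sum_diag_offdiag) (use offdiag that in auto)
      then show ?thesis
        by (simp add: QP that diag n_def norm_divide power_divide)
    qed
    then have block: "(\<Sum>i\<in>S. \<Sum>j\<in>S. (cmod (Q $ i $ j))\<^sup>2) = z * ((k / n)\<^sup>2 + (z - 1) * \<beta>\<^sup>2)"
      by (simp add: z_def)
    have "(\<Sum>i\<in>S. Re (Q $ i $ i)) = z * (k / n)"
      by (simp add: QP diag z_def n_def)
    with orthogonal_projector_block_trace[OF Q, of S] block trQ
    have "(z * (k / n))\<^sup>2 \<le> (k - 1) * (z * ((k / n)\<^sup>2 + (z - 1) * \<beta>\<^sup>2))"
      by simp
    \<comment> \<open>The factor clears all denominators and makes \<open>\<beta>\<^sup>2\<close> expressible by k and n; what remains is
        divisible by z and k.\<close>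
    then have "(n\<^sup>2 * (n - 1)) * (z * (k / n))\<^sup>2
        \<le> (n\<^sup>2 * (n - 1)) * ((k - 1) * (z * ((k / n)\<^sup>2 + (z - 1) * \<beta>\<^sup>2)))"
      using n by (intro mult_left_mono) auto
    moreover have "(n\<^sup>2 * (n - 1)) * (z * (k / n))\<^sup>2 = (z * k) * (z * k * (n - 1))"
      using n by (simp add: field_simps power2_eq_square)
    moreover have "(n\<^sup>2 * (n - 1)) * ((k - 1) * (z * ((k / n)\<^sup>2 + (z - 1) * \<beta>\<^sup>2)))
       = (k - 1) * z * ((n - 1) * (n\<^sup>2 * (k / n)\<^sup>2) + (z - 1) * (n\<^sup>2 * (n - 1) * \<beta>\<^sup>2))"
      by (simp add: algebra_simps)
    moreover have "\<dots> = (z * k) * ((k - 1) * (k * (n - 1) + (z - 1) * (n - k)))"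
      unfolding \<beta> using n by (simp add: power_divide) (simp add: algebra_simps power2_eq_square)
    ultimately have "(z * k) * (z * k * (n - 1))
        \<le> (z * k) * ((k - 1) * (k * (n - 1) + (z - 1) * (n - k)))"
      by (simp only:)
    then have "z * k * (n - 1) \<le> (k - 1) * (k * (n - 1) + (z - 1) * (n - k))"
      using z k by (simp add: mult_le_cancel_left_pos)
    then show ?thesis
      by (simp add: algebra_simps power2_eq_square)
  qed (use n in auto)
  moreover have "z = n - real (l0_norm x)"
  proof -
    have "{i. x $ i \<noteq> 0} = UNIV - S"
      by (auto simp: S_def)
    then show ?thesis
      by (simp add: l0_norm_def card_Diff_subset of_nat_diff card_mono n_def z_def)
  qed
  ultimately have "(n - real (l0_norm x)) * (n - 1 + (k - 1)\<^sup>2) \<le> n * (k - 1)\<^sup>2"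
    by (simp only:)
  then have "n * (n - 1) \<le> real (l0_norm x) * (n - 1 + (k - 1)\<^sup>2)"
    by (simp add: algebra_simps)
  moreover have "n - 1 + (k - 1)\<^sup>2 > 0"
    using n by (simp add: add_pos_nonneg)
  moreover have "n * inverse (1 + (k - 1)\<^sup>2 / (n - 1)) = n * (n - 1) / (n - 1 + (k - 1)\<^sup>2)"
    using n by (simp add: field_simps)
  ultimately show ?thesis
    by (simp add: pos_divide_le_eq flip: n_def)
qed

section \<open>The projector onto the row space of a tight frame\<close>

definition row_projector :: "complex ^ 'n ^ 'r \<Rightarrow> complex ^ 'n ^ 'n" where
  "row_projector V = (real CARD('r) / real CARD('n)) *\<^sub>R (\<Sum>a\<in>UNIV. outer (row a V) (row a V))"

text \<open>
  The entries form the rescaled Gram matrix of the columns, while the action on vectors in the next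
  lemma is governed by the rows.  The first view gives equiangularity, the second the range.
\<close>

lemma row_projector_nth:
  fixes V :: "complex ^ 'n ^ 'r"
  shows "row_projector V $ i $ j
    = complex_of_real (real CARD('r) / real CARD('n)) * hermitian_inner (column i V) (column j V)"
  by (simp add: row_projector_def outer_nth hermitian_inner_def row_def column_def
      scaleR_conv_of_real[where 'a=complex])

lemma row_projector_mult_vec:
  fixes V :: "complex ^ 'n ^ 'r"
  shows "row_projector V *v x = (\<Sum>a\<in>UNIV.
    (complex_of_real (real CARD('r) / real CARD('n)) * hermitian_inner x (row a V)) *s row a V)"
proof -
  have "(\<Sum>j\<in>UNIV. row_projector V $ i $ j * x $ j)
    = (\<Sum>j\<in>UNIV. \<Sum>a\<in>UNIV. complex_of_real (real CARD('r) / real CARD('n))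
        * (x $ j * cnj (row a V $ j)) * row a V $ i)" for i
    by (simp add: row_projector_def outer_nth scaleR_conv_of_real[where 'a=complex]
        sum_distrib_left sum_distrib_right mult_ac)
  also have "\<dots> i = (\<Sum>a\<in>UNIV. \<Sum>j\<in>UNIV. complex_of_real (real CARD('r) / real CARD('n))
        * (x $ j * cnj (row a V $ j)) * row a V $ i)" for i
    by (rule sum.swap)
  finally show ?thesis
    by (simp add: vec_eq_iff matrix_vector_mult_def hermitian_inner_def
        sum_distrib_left sum_distrib_right)
qed

context
  fixes v :: "'n::finite \<Rightarrow> complex ^ 'r" and V :: "complex ^ 'n ^ 'r"
  assumes untf: "unit_norm_tight_frame v" and columns: "\<And>i. column i V = v i"
begin

text \<open>
  The tight frame identity is an identity between r by r matrices; its (a, b) entry is the inner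
  product of the rows a and b of V.
\<close>

lemma tight_frame_rows_orthogonal:
  "hermitian_inner (row a V) (row b V)
    = (if a = b then complex_of_real (real CARD('n) / real CARD('r)) else 0)"
proof -
  have V: "V $ a $ i = v i $ a" for a i
    by (simp add: column_def flip: columns)
  have "hermitian_inner (row a V) (row b V) = (\<Sum>i\<in>UNIV. outer (v i) (v i)) $ a $ b"
    by (simp add: hermitian_inner_def row_def outer_nth V)
  also have "\<dots> = ((real CARD('n) / real CARD('r)) *\<^sub>R mat 1 :: complex ^ 'r ^ 'r) $ a $ b"
    using untf by (simp add: unit_norm_tight_frame_def)
  finally show ?thesis
    by (simp add: mat_def scaleR_conv_of_real[where 'a=complex])
qed

lemma row_projector_fixes_row_space:
  assumes "x \<in> vec.span (rows V)"
  shows "row_projector V *v x = x"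
proof -
  have "vec.subspace {x. row_projector V *v x = x}"
    by (auto simp: vec.subspace_def vec.add vec.scale)
  moreover have "rows V \<subseteq> {x. row_projector V *v x = x}"
    by (auto simp: rows_def row_projector_mult_vec tight_frame_rows_orthogonal
        if_distrib[of "\<lambda>c. _ * c"] if_distrib[of "\<lambda>c. c / _"]
        if_distrib[of "\<lambda>c. c *s _"] cong: if_cong)
  ultimately show ?thesis
    using vec.span_minimal assms by blast
qed

text \<open>The image of every vector is a combination of rows of V, hence is fixed.\<close>

lemma orthogonal_projector_row_projector: "orthogonal_projector (row_projector V)"
proof -
  have "row_projector V *v x \<in> vec.span (rows V)" for x
    unfolding row_projector_mult_vec
    by (intro vec.span_sum vec.span_scale vec.span_base) (auto simp: rows_def)
  then have "row_projector V ** row_projector V = row_projector V"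
    by (simp add: matrix_eq row_projector_fixes_row_space flip: matrix_vector_mul_assoc)
  then show ?thesis
    by (simp add: orthogonal_projector_def row_projector_nth cnj_hermitian_inner)
qed

lemma row_projector_diag:
  "row_projector V $ i $ i = complex_of_real (real CARD('r) / real CARD('n))"
  using untf by (simp add: row_projector_nth columns hermitian_inner_self unit_norm_tight_frame_def)

end

theorem corollary3p3:
  fixes v :: "'n::finite \<Rightarrow> complex ^ 'r"
    and V :: "complex ^ 'n ^ 'r"
  assumes "CARD('n) \<ge> 2"
    and "equiangular_tight_frame v"
    and "\<forall>i. column i V = v i"
  shows "real (sparsity V) \<ge>
           real CARD('n) * inverse (1 + (real CARD('r) - 1)\<^sup>2 / (real CARD('n) - 1)) \<and>
         ereal_of_enat (spark V) \<ge>
           ereal (real CARD('n) *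
             inverse (1 + (real CARD('n) - real CARD('r) - 1)\<^sup>2 / (real CARD('n) - 1)))"
proof -
  let ?P = "row_projector V"
  have untf: "unit_norm_tight_frame v" and columns: "\<And>i. column i V = v i"
    using assms by (auto simp: equiangular_tight_frame_def)
  obtain \<alpha> where \<alpha>: "\<And>i j. i \<noteq> j \<Longrightarrow> cmod (hermitian_inner (v i) (v j)) = \<alpha>"
    using assms(2) by (auto simp: equiangular_tight_frame_def)
  have P: "orthogonal_projector ?P"
    by (rule orthogonal_projector_row_projector[OF untf columns])
  have diag: "?P $ i $ i = complex_of_real (real CARD('r) / real CARD('n))" for i
    by (rule row_projector_diag[OF untf columns])
  have offdiag: "cmod (?P $ i $ j) = real CARD('r) / real CARD('n) * \<alpha>" if "i \<noteq> j" for i j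
    using \<alpha>[OF that] by (simp add: row_projector_nth columns norm_mult norm_divide)

  \<comment> \<open>The minimum defining the sparsity is attained, because V has a nonzero row.\<close>
  have "sparsity V \<in> l0_norm ` (vec.span (rows V) - {0})"
  proof -
    have "v undefined \<noteq> 0"
      using untf by (metis norm_zero unit_norm_tight_frame_def zero_neq_one)
    then obtain a where "v undefined $ a \<noteq> 0"
      by (auto simp: vec_eq_iff)
    then have "row a V $ undefined \<noteq> 0"
      by (simp add: row_def column_def flip: columns)
    then have "row a V \<noteq> 0"
      by auto
    moreover have "row a V \<in> vec.span (rows V)"
      by (intro vec.span_base) (auto simp: rows_def)
    ultimately show ?thesis
      unfolding sparsity_def by (intro Inf_nat_def1) auto
  qed
  then obtain x where "x \<in> vec.span (rows V)" "x \<noteq> 0" "sparsity V = l0_norm x"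
    by auto
  then have sparsity: "real (sparsity V) \<ge>
      real CARD('n) * inverse (1 + (real CARD('r) - 1)\<^sup>2 / (real CARD('n) - 1))"
    using equiangular_projector_l0_norm_ge[OF assms(1) P diag offdiag]
      row_projector_fixes_row_space[OF untf columns] by simp

  have kernel: "real (l0_norm x) \<ge> real CARD('n) *
      inverse (1 + (real CARD('n) - real CARD('r) - 1)\<^sup>2 / (real CARD('n) - 1))"
    if x: "x \<noteq> 0" "V *v x = 0" for x
  proof -
    \<comment> \<open>The product of V and x pairs x with the rows of V without conjugation, so it is the
        conjugate of x that is orthogonal to the row space.\<close>
    define y where "y = (\<chi> i. cnj (x $ i))"
    have "hermitian_inner y (row a V) = cnj ((V *v x) $ a)" for a
      by (simp add: hermitian_inner_def y_def row_def matrix_vector_mult_def mult.commute)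
    then have "?P *v y = 0"
      by (simp add: row_projector_mult_vec x)
    then have y: "(mat 1 - ?P) *v y = y"
      by (simp add: matrix_vector_mult_diff_rdistrib)
    have "y \<noteq> 0"
      using x by (simp add: y_def vec_eq_iff)
    have diag': "(mat 1 - ?P) $ i $ i
        = complex_of_real ((real CARD('n) - real CARD('r)) / real CARD('n))" for i
      by (simp add: mat_def diag diff_divide_distrib)
    have offdiag': "cmod ((mat 1 - ?P) $ i $ j) = real CARD('r) / real CARD('n) * \<alpha>"
      if "i \<noteq> j" for i j
      using offdiag[OF that] that by (simp add: mat_def)
    have "l0_norm y = l0_norm x"
      by (simp add: l0_norm_def y_def)
    then show ?thesis
      using equiangular_projector_l0_norm_ge[OF assms(1) orthogonal_projector_complement[OF P]
          diag' offdiag' y \<open>y \<noteq> 0\<close>] by simp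
  qed
  have "ereal_of_enat (spark V) \<ge> ereal (real CARD('n) *
      inverse (1 + (real CARD('n) - real CARD('r) - 1)\<^sup>2 / (real CARD('n) - 1)))"
  proof (cases "\<exists>x. x \<noteq> 0 \<and> V *v x = 0")
    case True
    then have "spark V \<in> (\<lambda>x. enat (l0_norm x)) ` {x. x \<noteq> 0 \<and> V *v x = 0}"
      unfolding spark_def by (auto intro!: wellorder_InfI)
    then show ?thesis
      using kernel by auto
  next
    case False
    then have "{x. x \<noteq> 0 \<and> V *v x = 0} = {}"
      by blast
    then have "spark V = \<infinity>"
      unfolding spark_def by (simp only: image_empty Inf_empty top_enat_def)
    then show ?thesis
      by simp
  qed
  with sparsity show ?thesis
    by blast
qed

end
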